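(* Any pair of quorums $Q_u,Q_v$ (of nodes $u$ and $v$) in the same grid quorum system $\Omega_g$ over a period of $m$ slots has at least $\left\lceil \frac{D_uD_v m}{4\varrho^2}\right\rceil$ rendezvous active time slots, even when the relative clock shift between the nodes is arbitrary. That is, for every (finite, integer number of slots) relative clock shift $t_\delta(u,v)$, $$\bigl|Q_u\cap \mathscr S\bigl(Q_v,\ t_\delta(u,v) \bmod m\bigr)\bigr|\ \ge\ \left\lceil \frac{D_uD_v m}{4\varrho^2}\right\rceil .$$
   Context: A period $T=\{\tau_1,\dots,\tau_m\}$ consists of $m$ time slots, identified with residues modulo $m$, where $\sqrt m$ is an integer. Each node $u$ has a demand $D_u$ (amount of data to be transmitted or received per unit time), with $0<D_u\le\varrho$, where $\varrho>0$ is the data rate. Grid quorum system $\Omega_g$: the $m$ slots of $T$ are placed in row-major order in a $\sqrt m\times\sqrt m$ grid, rows and columns numbered $1,\dots,\sqrt m$. Put $r_u=\left\lceil\frac{D_u\sqrt m}{2\varrho}\right\rceil$. A quorum for node $u$ with index $i$, where $1\le i\le \sqrt m+1-r_u$, is the set of all slots lying in the $r_u$ consecutive rows starting from row $i$ or in the $r_u$ consecutive columns starting from column $i$. Rotation: for a quorum $Q$ and a non-negative integer $i$, $\mathscr S(Q,i)=\{(\tau_j+i)\bmod m : \tau_j\in Q\}$. Clock shift: $t_\delta^u$ is the difference between the local time of $u$'s clock and the exact time; the relative clock shift of $u$ and $v$ is $t_\delta(u,v)=t_\delta^u-t_\delta^v$, assumed finite. With relative shift $t_\delta(u,v)$, the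 slots of $Q_v$ become the rotated set $\mathscr S(Q_v,t_\delta(u,v)\bmod m)$ relative to $u$'s clock, and the rendezvous active slots are the slots common to it and $Q_u$. Interference is not taken into account. *)

theory Defs
  imports Complex_Main
begin

definition grid_side :: "nat \<Rightarrow> nat" where
  "grid_side m = nat \<lfloor>sqrt (real m)\<rfloor>"

text \<open>
  The slots of a period of length \<open>m\<close> are the residues \<open>0, \<dots>, m - 1\<close>, the slot
  \<open>\<tau>\<^sub>j\<close> being the residue \<open>j - 1\<close>. In row-major order the first slot is thus at
  row 1 and column 1. Rows and columns are numbered from 1.
\<close>

definition slots :: "nat \<Rightarrow> nat set" where
  "slots m = {0..<m}"

definition grid_row :: "nat \<Rightarrow> nat \<Rightarrow> nat" where
  "grid_row m s = s div grid_side m + 1"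

definition grid_col :: "nat \<Rightarrow> nat \<Rightarrow> nat" where
  "grid_col m s = s mod grid_side m + 1"

definition quorum_width :: "nat \<Rightarrow> real \<Rightarrow> real \<Rightarrow> nat" where
  "quorum_width m \<rho> d = nat \<lceil>d * sqrt (real m) / (2 * \<rho>)\<rceil>"

definition grid_quorum :: "nat \<Rightarrow> real \<Rightarrow> real \<Rightarrow> nat \<Rightarrow> nat set" where
  "grid_quorum m \<rho> d i =
     {s \<in> slots m. grid_row m s \<in> {i..<i + quorum_width m \<rho> d}
                 \<or> grid_col m s \<in> {i..<i + quorum_width m \<rho> d}}"

text \<open>
  The grid quorum system is given as the family, indexed by the nodes \<open>u\<close>, of the
  sets of quorums available to \<open>u\<close>; \<open>\<rho>\<close> is the data rate and \<open>D\<close> the demand.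
\<close>

definition grid_quorum_system ::
    "nat \<Rightarrow> real \<Rightarrow> ('node \<Rightarrow> real) \<Rightarrow> 'node \<Rightarrow> nat set set" where
  "grid_quorum_system m \<rho> D u =
     {grid_quorum m \<rho> (D u) i | i. 1 \<le> i \<and> i \<le> grid_side m + 1 - quorum_width m \<rho> (D u)}"

definition rotation :: "nat \<Rightarrow> nat set \<Rightarrow> nat \<Rightarrow> nat set" where
  "rotation m Q i = (\<lambda>s. (s + i) mod m) ` Q"

text \<open>Clock shifts are measured in slots.\<close>

definition relative_clock_shift :: "('node \<Rightarrow> real) \<Rightarrow> 'node \<Rightarrow> 'node \<Rightarrow> real" where
  "relative_clock_shift t u v = t u - t v"

text \<open>
  The shift \<open>k\<close> may be negative; \<open>k mod int m\<close> is the residue in \<open>{0..<m}\<close>.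
\<close>

definition rendezvous_slots :: "nat \<Rightarrow> nat set \<Rightarrow> nat set \<Rightarrow> int \<Rightarrow> nat set" where
  "rendezvous_slots m Qu Qv k = Qu \<inter> rotation m Qv (nat (k mod int m))"

end

theory Submission
  imports Defs
begin

text \<open>
  Write \<open>m = q\<^sup>2\<close>. The rows of a quorum of width \<open>b\<close> are \<open>b * q\<close> consecutive slots, and a rotation
  turns them into \<open>b * q\<close> cyclically consecutive slots. These meet every column of the grid, i.e.\
  every residue class modulo \<open>q\<close>, exactly \<open>b\<close> times, so they share \<open>a * b\<close> slots with the \<open>a\<close>
  columns of the other quorum. Rounding up in the widths gives
  \<open>a * b \<ge> D\<^sub>u D\<^sub>v m / (4 \<rho>\<^sup>2)\<close>.
\<close>

lemma inj_on_mod_atLeastLessThan: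
  fixes x q :: nat
  shows "inj_on (\<lambda>s. s mod q) {x..<x + q}"
proof (rule linorder_inj_onI')
  fix s s' assume s: "s \<in> {x..<x + q}" "s' \<in> {x..<x + q}" "s < s'"
  show "s mod q \<noteq> s' mod q"
  proof
    assume "s mod q = s' mod q"
    hence "q dvd s' - s" using s(3) by (metis mod_eq_dvd_iff_nat less_imp_le)
    moreover have "0 < s' - s" "s' - s < q" using s by auto
    ultimately show False using nat_dvd_not_less by blast
  qed
qed

text \<open>By injectivity and counting, reduction modulo \<open>q\<close> maps \<open>q\<close>
  consecutive numbers bijectively onto the residues, so each element of \<open>C\<close> is hit
  exactly once.\<close>

lemma card_residues_block:
  fixes x q :: nat
  assumes "C \<subseteq> {..<q}"
  shows "card {s \<in> {x..<x + q}. s mod q \<in> C} = card C"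
proof -
  let ?f = "\<lambda>s. s mod q"
  have "?f ` {x..<x + q} = {..<q}"
  proof (rule card_subset_eq)
    show "?f ` {x..<x + q} \<subseteq> {..<q}" by (cases "q = 0") auto
    show "card (?f ` {x..<x + q}) = card {..<q}"
      using card_image[OF inj_on_mod_atLeastLessThan[where x = x and q = q]] by simp
  qed simp
  hence "C \<subseteq> ?f ` {x..<x + q}" using assms by simp
  hence "?f ` {s \<in> {x..<x + q}. s mod q \<in> C} = C" unfolding subset_image_iff by blast
  moreover have "inj_on ?f {s \<in> {x..<x + q}. s mod q \<in> C}"
    by (rule inj_on_subset[OF inj_on_mod_atLeastLessThan[where x = x and q = q]]) auto
  ultimately show ?thesis by (metis card_image)
qed

lemma card_residues_blocks:
  fixes x q b :: nat
  assumes "C \<subseteq> {..<q}"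
  shows "card {s \<in> {x..<x + b * q}. s mod q \<in> C} = b * card C"
proof (induction b)
  case (Suc b)
  let ?A = "{s \<in> {x..<x + b * q}. s mod q \<in> C}"
  let ?B = "{s \<in> {x + b * q..<x + b * q + q}. s mod q \<in> C}"
  have "{s \<in> {x..<x + Suc b * q}. s mod q \<in> C} = ?A \<union> ?B" by auto
  moreover have "card (?A \<union> ?B) = card ?A + card ?B" by (rule card_Un_disjoint) auto
  ultimately show ?case using Suc.IH card_residues_block[OF assms] by simp
qed simp

text \<open>Rows are numbered from 1 but slots from 0, so row \<open>j\<close> begins at slot
  \<open>(j - 1) * grid_side m\<close>. The upper bound on \<open>j\<close> keeps the last row
  inside the grid.\<close>

lemma rows_subset_grid_quorum:
  assumes "grid_side m * grid_side m = m" and "1 \<le> j" and "j + quorum_width m \<rho> d \<le> grid_side m + 1"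
  shows "{(j - 1) * grid_side m..<(j - 1 + quorum_width m \<rho> d) * grid_side m} \<subseteq> grid_quorum m \<rho> d j"
proof
  let ?q = "grid_side m" and ?b = "quorum_width m \<rho> d"
  fix s assume s: "s \<in> {(j - 1) * ?q..<(j - 1 + ?b) * ?q}"
  hence "?q > 0" by (cases "?q = 0") auto
  hence "j - 1 \<le> s div ?q" "s div ?q < j - 1 + ?b"
    using s by (auto simp: less_eq_div_iff_mult_less_eq div_less_iff_less_mult)
  moreover have "(j - 1 + ?b) * ?q \<le> ?q * ?q" by (rule mult_right_mono) (use assms in auto)
  hence "s < m" using s assms(1) by auto
  ultimately show "s \<in> grid_quorum m \<rho> d j"
    using assms(2) by (auto simp: grid_quorum_def slots_def grid_row_def)
qed

lemma card_grid_quorum_Int_rotation: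
  assumes m: "grid_side m * grid_side m = m"
    and i: "1 \<le> i" "i + quorum_width m \<rho> c \<le> grid_side m + 1"
    and j: "1 \<le> j" "j + quorum_width m \<rho> d \<le> grid_side m + 1"
  shows "quorum_width m \<rho> c * quorum_width m \<rho> d
    \<le> card (grid_quorum m \<rho> c i \<inter> rotation m (grid_quorum m \<rho> d j) K)"
proof (cases "m = 0")
  case True
  hence "quorum_width m \<rho> c = 0" by (simp add: quorum_width_def)
  thus ?thesis by simp
next
  case False
  let ?q = "grid_side m" and ?a = "quorum_width m \<rho> c" and ?b = "quorum_width m \<rho> d"
  \<comment> \<open>The rotated rows are first followed without wrap-around: they start at
    \<open>x\<close>, and \<open>P\<close> keeps those in the columns of the first quorum, where
    column \<open>i\<close> is the residue \<open>i - 1\<close>.\<close>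
  define x where "x = (j - 1) * ?q + K"
  define P where "P = {s \<in> {x..<x + ?b * ?q}. s mod ?q \<in> {i - 1..<i - 1 + ?a}}"
  have dvd: "?q dvd m" using m by (metis dvd_triv_left)
  \<comment> \<open>As \<open>?b \<le> ?q\<close>, the set \<open>P\<close> fits into
    \<open>m\<close> consecutive numbers, so wrapping around modulo \<open>m\<close> identifies no
    two of its elements.\<close>
  have "?b * ?q \<le> ?q * ?q" by (rule mult_right_mono) (use j in auto)
  hence "P \<subseteq> {x..<x + m}" using m by (auto simp: P_def)
  hence inj: "inj_on (\<lambda>s. s mod m) P"
    by (rule inj_on_subset[OF inj_on_mod_atLeastLessThan])
  have "(\<lambda>s. s mod m) ` P \<subseteq> grid_quorum m \<rho> c i \<inter> rotation m (grid_quorum m \<rho> d j) K"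
  proof (rule image_subsetI)
    fix n assume n: "n \<in> P"
    \<comment> \<open>Wrapping around preserves the column, because the side of the grid divides
      \<open>m\<close>.\<close>
    have "n mod m mod ?q = n mod ?q" using dvd by (simp add: mod_mod_cancel)
    hence "n mod m \<in> grid_quorum m \<rho> c i"
      using n i(1) False by (auto simp: P_def grid_quorum_def slots_def grid_col_def)
    \<comment> \<open>Since \<open>K \<le> x \<le> n\<close>, the subtraction does not truncate;
      \<open>n - K\<close> is the slot that the rotation sends to \<open>n mod m\<close>.\<close>
    moreover have "n - K \<in> {(j - 1) * ?q..<(j - 1 + ?b) * ?q}" "n = n - K + K"
      using n by (auto simp: P_def x_def add_mult_distrib)
    hence "n mod m \<in> rotation m (grid_quorum m \<rho> d j) K"
      using rows_subset_grid_quorum[OF m j] unfolding rotation_def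
      by (intro image_eqI[where x = "n - K"]) (simp, rule subsetD)
    ultimately show "n mod m \<in> grid_quorum m \<rho> c i \<inter> rotation m (grid_quorum m \<rho> d j) K" by simp
  qed
  moreover have "finite (grid_quorum m \<rho> c i)" by (simp add: grid_quorum_def slots_def)
  ultimately have "card ((\<lambda>s. s mod m) ` P)
      \<le> card (grid_quorum m \<rho> c i \<inter> rotation m (grid_quorum m \<rho> d j) K)"
    by (intro card_mono) auto
  moreover have "{i - 1..<i - 1 + ?a} \<subseteq> {..<?q}" using i by auto
  hence "card P = ?b * ?a" unfolding P_def by (subst card_residues_blocks) simp_all
  ultimately show ?thesis using card_image[OF inj] by (simp add: mult.commute)
qed

text \<open>The floor in \<open>grid_side\<close> is exact when the square root is an
  integer.\<close>

lemma grid_side_square: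
  assumes "sqrt (real m) \<in> \<int>"
  shows "grid_side m * grid_side m = m"
proof -
  obtain z where z: "sqrt (real m) = of_int z" using assms by (rule Ints_cases)
  moreover have "0 \<le> z" using z by (metis of_int_0_le_iff real_sqrt_ge_zero of_nat_0_le_iff)
  ultimately have "real (grid_side m) = sqrt (real m)" by (simp add: grid_side_def)
  hence "real (grid_side m * grid_side m) = real m" by simp
  thus ?thesis by linarith
qed

text \<open>Since \<open>1 \<le> i\<close>, the natural-number difference bounding \<open>i\<close>
  is positive, hence not truncated, and can be turned into a sum.\<close>

lemma grid_quorum_systemE:
  assumes "Q \<in> grid_quorum_system m \<rho> D w"
  obtains i where "Q = grid_quorum m \<rho> (D w) i" "1 \<le> i"
    "i + quorum_width m \<rho> (D w) \<le> grid_side m + 1"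
  using assms by (fastforce simp: grid_quorum_system_def)

theorem lemma3:
  fixes m :: nat and \<rho> :: real
    and D :: "'node \<Rightarrow> real" and t :: "'node \<Rightarrow> real"
    and u v :: 'node and Qu Qv :: "nat set" and k :: int
  assumes "m > 0" and "sqrt (real m) \<in> \<int>"
    and "\<rho> > 0" and "\<And>w. 0 < D w \<and> D w \<le> \<rho>"
    and "Qu \<in> grid_quorum_system m \<rho> D u"
    and "Qv \<in> grid_quorum_system m \<rho> D v"
    and "relative_clock_shift t u v = of_int k"
  shows "int (card (rendezvous_slots m Qu Qv k)) \<ge> \<lceil>D u * D v * real m / (4 * \<rho>\<^sup>2)\<rceil>"
proof -
  let ?r = "\<lambda>w. quorum_width m \<rho> (D w)"
  have width: "D w * sqrt (real m) / (2 * \<rho>) \<le> real (?r w)" for w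
    unfolding quorum_width_def by (rule of_nat_ceiling)
  \<comment> \<open>Writing \<open>m\<close> as a product of two square roots splits the bound into
    the two quantities whose ceilings are the widths.\<close>
  have "D u * D v * real m / (4 * \<rho>\<^sup>2)
      = D u * D v * (sqrt (real m) * sqrt (real m)) / (4 * \<rho>\<^sup>2)" by simp
  also have "\<dots> = (D u * sqrt (real m) / (2 * \<rho>)) * (D v * sqrt (real m) / (2 * \<rho>))"
    by (simp only: power2_eq_square times_divide_times_eq) (simp add: mult_ac)
  also have "\<dots> \<le> real (?r u) * real (?r v)"
    using assms(3,4) by (intro mult_mono width) (auto simp: less_imp_le)
  finally have bound: "D u * D v * real m / (4 * \<rho>\<^sup>2) \<le> real (?r u * ?r v)" by simp
  obtain i where i: "Qu = grid_quorum m \<rho> (D u) i" "1 \<le> i" "i + ?r u \<le> grid_side m + 1"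
    using assms(5) by (rule grid_quorum_systemE)
  obtain j where j: "Qv = grid_quorum m \<rho> (D v) j" "1 \<le> j" "j + ?r v \<le> grid_side m + 1"
    using assms(6) by (rule grid_quorum_systemE)
  \<comment> \<open>The crossing bound holds for every rotation amount, in particular for the
    residue of the clock shift.\<close>
  have "?r u * ?r v \<le> card (rendezvous_slots m Qu Qv k)"
    unfolding rendezvous_slots_def i(1) j(1)
    by (rule card_grid_quorum_Int_rotation[OF grid_side_square[OF assms(2)] i(2,3) j(2,3)])
  hence "real (?r u * ?r v) \<le> real (card (rendezvous_slots m Qu Qv k))" by (rule of_nat_mono)
  with bound show ?thesis by (simp add: ceiling_le_iff)
qed

end
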